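(* Let $m$ be a positive integer with $m\equiv 2\pmod 4$, and let $n$ be a positive integer with $m\le 2^{n+1}-3$. Then the tuples $\mathbf{j}_{\max}\in J$ at which $V$ attains its maximum over $J$ are exactly the following (all entries not displayed are $0$; the displayed nonzero entries are the last ones): \begin{enumerate} \item If $m+1\equiv 0\pmod 3$: the single tuple $\mathbf{j}_{\max}=(0,\ldots,0,p,0)$ with $p=(m+1)/3$. \item If $m+1\equiv 1\pmod 3$: the single tuple $\mathbf{j}_{\max}=(0,\ldots,0,p,1)$ with $p=m/3$. \item If $m+1\equiv 2\pmod 3$: (a) if $m\equiv 2\pmod 8$: the single tuple $\mathbf{j}_{\max}=(0,\ldots,0,p,2)$ with $p=(m-1)/3$; (b) if $m\equiv 46\pmod{48}$: the single tuple $\mathbf{j}_{\max}=(0,\ldots,0,1,p-2,1)$ with $p=(m-1)/3$; (c) if $m\equiv 22\pmod{48}$: the three tuples $(0,\ldots,0,1,(m-7)/3,1)$, $(0,\ldots,0,(m-1)/3,2)$ and $(0,\ldots,0,(m-4)/3,5)$. \end{enumerate}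
   Context: For positive integers $m,n$ with $m\le 2^{n+1}-3$, $J$ is the set of $n$-tuples $\mathbf{j}=(j_1,\ldots,j_n)$ of non-negative integers with $$(2^n-1)j_1+(2^{n-1}-1)j_2+\cdots+(2^2-1)j_{n-1}+(2-1)j_n=m+1.$$ For $\mathbf{j}\in J$ and $1\le k\le n$ put $$\alpha(k)=\alpha_{\mathbf{j}}(k)=\frac{m}{2^{n-k+1}}-2^{k-1}j_1-2^{k-2}j_2-\cdots-2j_{k-1},$$ and let $C_{j}(\alpha)=\frac{\alpha(\alpha-1)\cdots(\alpha-(j-1))}{j!}$ be the generalized binomial coefficient (with $C_0(\alpha)=1$). Let $\nu$ be the 2-adic valuation on $\mathbb{Q}$, with $\nu(0)=\infty$, and define $$V(\mathbf{j})=-\nu\Bigl(\prod_{k=1}^n C_{j_k}(\alpha(k))\Bigr)\in\mathbb{Z}\cup\{-\infty\}.$$ *)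

theory Defs
  imports
    Complex_Main
    "HOL-Library.Extended"
    "HOL-Computational_Algebra.Primes"
begin

text \<open>
  An \<open>n\<close>-tuple is a list \<open>js\<close> of length \<open>n\<close>. The mathematical indices are 1-based, so
  \<open>entry js k\<close> is \<open>j\<^sub>k\<close> for \<open>1 \<le> k \<le> n\<close>.
\<close>

definition entry :: "nat list \<Rightarrow> nat \<Rightarrow> nat" where
  "entry js k = js ! (k - 1)"

definition J :: "nat \<Rightarrow> nat \<Rightarrow> nat list set" where
  "J m n = {js. length js = n \<and> (\<Sum>k=1..n. (2 ^ (n - k + 1) - 1) * entry js k) = m + 1}"

definition \<alpha> :: "nat \<Rightarrow> nat \<Rightarrow> nat list \<Rightarrow> nat \<Rightarrow> rat" where
  "\<alpha> m n js k = of_nat m / 2 ^ (n - k + 1) - (\<Sum>i=1..<k. 2 ^ (k - i) * of_nat (entry js i))"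

definition nu2 :: "rat \<Rightarrow> int extended" where
  "nu2 x = (if x = 0 then \<infinity>
     else Fin (int (multiplicity 2 (fst (quotient_of x))) - int (multiplicity 2 (snd (quotient_of x)))))"

definition V :: "nat \<Rightarrow> nat \<Rightarrow> nat list \<Rightarrow> int extended" where
  "V m n js = - nu2 (\<Prod>k=1..n. (\<alpha> m n js k gchoose entry js k))"

definition maximizers :: "nat \<Rightarrow> nat \<Rightarrow> nat list set" where
  "maximizers m n = {js. is_arg_max (V m n) (\<lambda>i. i \<in> J m n) js}"

end

theory Submission
  imports Defs
begin

text \<open>
  Write \<open>x\<^sub>i\<close> for the entry of weight \<open>2^i - 1\<close>, that is, the entry of index \<open>n - i + 1\<close>; let \<open>t = x\<^sub>1\<close>
  be the last entry, and let \<open>u(x)\<close> be the 2-adic valuation of \<open>x!\<close>.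

  For \<open>i \<ge> 2\<close> the number \<open>\<alpha>(k)\<close> is an odd integer over \<open>2^(i-1)\<close>, because \<open>m\<close> is twice an odd number.
  Every factor in the numerator of the binomial coefficient is then odd over \<open>2^(i-1)\<close>, so the
  coefficient contributes exactly \<open>(i-1) x\<^sub>i + u(x\<^sub>i)\<close> to \<open>V\<close>. For \<open>i = 1\<close> the defining equation of \<open>J\<close>
  gives \<open>\<alpha>(n) = t - 1 - N\<close>, where \<open>2N + 1\<close> is the sum of all entries (odd by parity), so that this
  coefficient is the ordinary binomial coefficient \<open>N choose t\<close> up to sign. Hence
  \<open>V = gain - \<nu>(N choose t)\<close>, where \<open>gain\<close> is the sum of the contributions with \<open>i \<ge> 2\<close>
  (\<open>V_eq\<close>).

  Let \<open>m + 1 = 3p + c\<close> with \<open>0 \<le> c \<le> 2\<close>. The tuple \<open>(0,\<dots>,0,p,c)\<close> has gain \<open>p + u(p)\<close>, and every other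
  tuple has a smaller one (\<open>gain_less\<close>). To see this, put \<open>W = p - x\<^sub>2\<close>; then \<open>3W + c\<close> is the total
  weight of the entries other than \<open>x\<^sub>2\<close>. Superadditivity of \<open>u\<close> gives
  \<open>p + u(p) \<ge> x\<^sub>2 + u(x\<^sub>2) + W + u(W)\<close>, so it is enough to compare \<open>W + u(W)\<close>, which is at least
  \<open>(3W - 1)/2\<close>, with the contributions for \<open>i \<ge> 3\<close>. The nonzero ones are less than \<open>i x\<^sub>i\<close>, which is less than
  half of the weight \<open>(2^i - 1) x\<^sub>i\<close> they use up; the slack is just sufficient.

  If the coefficient \<open>N choose c\<close> of the tuple \<open>(0,\<dots>,0,p,c)\<close> is odd, this tuple is therefore the only
  maximizer. That covers \<open>c = 0\<close>, \<open>c = 1\<close>, and \<open>c = 2\<close> with \<open>m \<equiv> 2 (mod 8)\<close>. In the remaining cases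
  \<open>c = 2\<close> and \<open>p \<equiv> 7 (mod 8)\<close>, and the coefficient is even. Following the slack in the same estimate
  shows that only \<open>(0,\<dots>,0,1,p-2,1)\<close> and \<open>(0,\<dots>,0,p-1,5)\<close> have gain \<open>p + u(p) - 1\<close>, and all further
  tuples have less (\<open>gain_second_largest\<close>). For the first of the two the coefficient \<open>N choose t\<close> is
  odd, so the maximum of \<open>V\<close> is \<open>p + u(p) - 1\<close>. Whether \<open>(0,\<dots>,0,p,2)\<close> and \<open>(0,\<dots>,0,p-1,5)\<close> also
  attain it depends on \<open>(p+1)/2 choose 2\<close> and \<open>(p+3)/2 choose 5\<close>: for \<open>p \<equiv> 7 (mod 16)\<close> their
  valuations are \<open>1\<close> and \<open>0\<close>, so both do, and for \<open>p \<equiv> 15 (mod 16)\<close> the valuations are at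
  least \<open>2\<close> and \<open>1\<close>, so neither does.
\<close>

section \<open>The 2-adic valuation of factorials\<close>

definition fact_val :: "nat \<Rightarrow> nat" where
  "fact_val j = multiplicity 2 (fact j :: nat)"

lemma fact_val_0 [simp]: "fact_val 0 = 0"
  by (simp add: fact_val_def)

lemma fact_val_Suc: "fact_val (Suc j) = fact_val j + multiplicity 2 (Suc j)"
proof -
  have "multiplicity 2 (Suc j * fact j) = multiplicity 2 (Suc j) + multiplicity 2 (fact j :: nat)"
    by (rule prime_elem_multiplicity_mult_distrib) auto
  then show ?thesis
    by (simp add: fact_val_def)
qed

lemma fact_val_Suc_even: "even j \<Longrightarrow> fact_val (Suc j) = fact_val j"
  by (simp add: fact_val_Suc not_dvd_imp_multiplicity_0)

lemma fact_val_double: "fact_val (2 * k) = k + fact_val k"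
proof (induction k)
  case (Suc k)
  have "multiplicity 2 (2 * Suc k) = Suc (multiplicity 2 (Suc k))"
    by (rule multiplicity_times_same) auto
  moreover have "fact_val (2 * Suc k) = fact_val (2 * k) + multiplicity 2 (2 * Suc k)"
    using fact_val_Suc_even[of "2 * k"] fact_val_Suc[of "Suc (2 * k)"] by simp
  ultimately show ?case
    using Suc by (simp add: fact_val_Suc)
qed simp

lemma fact_val_small [simp]: "fact_val (Suc 0) = 0" "fact_val 2 = 1" "fact_val 4 = 3"
proof -
  show 1: "fact_val (Suc 0) = 0"
    by (simp add: fact_val_def)
  show 2: "fact_val 2 = 1"
    using fact_val_double[of 1] 1 by simp
  show "fact_val 4 = 3"
    using fact_val_double[of 2] 2 by simp
qed

text \<open>Binomial coefficients are integers: \<open>a! b!\<close> divides \<open>(a + b)!\<close>.\<close>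

lemma fact_val_superadditive: "fact_val a + fact_val b \<le> fact_val (a + b)"
proof -
  have "fact_val a + fact_val b = multiplicity 2 (fact a * fact b :: nat)"
    unfolding fact_val_def by (rule prime_elem_multiplicity_mult_distrib[symmetric]) auto
  also have "\<dots> \<le> fact_val (a + b)"
    unfolding fact_val_def by (rule dvd_imp_multiplicity_le) (auto simp: fact_fact_dvd_fact)
  finally show ?thesis .
qed

text \<open>
  By Legendre's formula \<open>x - fact_val x\<close> is the binary digit sum of \<open>x\<close>. This lemma says that it is
  positive for \<open>x > 0\<close>, and \<open>fact_val_ge\<close> that it is at most \<open>(x + 1) / 2\<close>; both come from the
  halving recursion \<open>fact_val_double\<close>.
\<close>

lemma fact_val_less: "x > 0 \<Longrightarrow> fact_val x < x"
proof (induction x rule: less_induct)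
  case (less x)
  show ?case
  proof (cases "x = 1")
    case False
    define k where "k = x div 2"
    have k: "0 < k" "k < x"
      using less.prems False by (auto simp: k_def)
    have "x = 2 * k \<or> x = Suc (2 * k)"
      unfolding k_def by presburger
    then have "fact_val x = k + fact_val k"
      by (auto simp: fact_val_double fact_val_Suc_even)
    moreover have "2 * k \<le> x"
      by (simp add: k_def)
    ultimately show ?thesis
      using less.IH[of k] k by simp
  qed simp
qed

lemma fact_val_ge: "x \<le> 2 * fact_val x + 1"
proof -
  define k where "k = x div 2"
  have "x = 2 * k \<or> x = Suc (2 * k)"
    unfolding k_def by presburger
  then show ?thesis
    by (auto simp: fact_val_double fact_val_Suc_even)
qed

section \<open>The 2-adic valuation of rationals and of generalized binomial coefficients\<close>

text \<open>
  The value of \<open>nu2\<close> may be read off from any fraction, reduced or not, because cross-multiplication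
  with the reduced one preserves the difference of multiplicities.
\<close>

lemma nu2_divide:
  assumes "a \<noteq> 0" "b \<noteq> 0"
  shows "nu2 (of_int a / of_int b) = Fin (int (multiplicity 2 a) - int (multiplicity 2 b))"
proof -
  define x :: rat where "x = of_int a / of_int b"
  obtain c d where cd: "quotient_of x = (c, d)"
    by (cases "quotient_of x")
  have d: "d > 0" and x: "x = of_int c / of_int d"
    using quotient_of_denom_pos[OF cd] quotient_of_div[OF cd] by auto
  have "x \<noteq> 0"
    using assms by (simp add: x_def)
  then have c: "c \<noteq> 0"
    using x by auto
  have "of_int a * of_int d = (of_int c * of_int b :: rat)"
    using x assms d unfolding x_def by (simp add: field_simps)
  then have "a * d = c * b"
    by (metis of_int_mult of_int_eq_iff)
  moreover have "multiplicity 2 (a * d) = multiplicity 2 a + multiplicity 2 d"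
    using assms d by (intro prime_elem_multiplicity_mult_distrib) auto
  moreover have "multiplicity 2 (c * b) = multiplicity 2 c + multiplicity 2 b"
    using assms c by (intro prime_elem_multiplicity_mult_distrib) auto
  ultimately have "int (multiplicity 2 c) - int (multiplicity 2 d)
      = int (multiplicity 2 a) - int (multiplicity 2 b)"
    by simp
  then show ?thesis
    using \<open>x \<noteq> 0\<close> cd unfolding x_def[symmetric] nu2_def by simp
qed

lemma multiplicity_2_int: "multiplicity 2 (int a) = multiplicity 2 a" if "a > 0"
proof (rule multiplicity_eqI)
  show "2 ^ multiplicity 2 a dvd int a"
    using multiplicity_dvd[of 2 a] by (metis int_dvd_int_iff of_nat_numeral of_nat_power)
  have "\<not> 2 ^ Suc (multiplicity 2 a) dvd a"
    using that by (subst power_dvd_iff_le_multiplicity) auto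
  then show "\<not> 2 ^ Suc (multiplicity 2 a) dvd int a"
    by (metis int_dvd_int_iff of_nat_numeral of_nat_power)
qed

lemma nu2_of_nat: "a > 0 \<Longrightarrow> nu2 (of_nat a) = Fin (int (multiplicity 2 a))"
  using nu2_divide[of "int a" 1] multiplicity_2_int[of a] by simp

lemma nu2_mult: "nu2 (x * y) = nu2 x + nu2 y"
proof (cases "x = 0 \<or> y = 0")
  case True
  then show ?thesis
    by (auto simp: nu2_def)
next
  case False
  obtain a b where x: "x = of_int a / of_int b" and b: "b > 0"
    by (metis quotient_of_denom_pos quotient_of_div surj_pair)
  obtain c d where y: "y = of_int c / of_int d" and d: "d > 0"
    by (metis quotient_of_denom_pos quotient_of_div surj_pair)
  have ac: "a \<noteq> 0" "c \<noteq> 0"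
    using False x y by auto
  have "x * y = of_int (a * c) / of_int (b * d)"
    by (simp add: x y)
  moreover have "multiplicity 2 (a * c) = multiplicity 2 a + multiplicity 2 c"
    using ac by (intro prime_elem_multiplicity_mult_distrib) auto
  moreover have "multiplicity 2 (b * d) = multiplicity 2 b + multiplicity 2 d"
    using b d by (intro prime_elem_multiplicity_mult_distrib) auto
  ultimately show ?thesis
    using ac b d nu2_divide[of "a * c" "b * d"] by (simp add: x y nu2_divide)
qed

lemma nu2_minus: "nu2 (- x) = nu2 x"
  using nu2_mult[of "- 1" x] nu2_divide[of "- 1" 1] zero_extended_def[where 'a = int]
  by (cases "nu2 x") (auto simp: not_dvd_imp_multiplicity_0)

lemma nu2_prod:
  assumes "finite A" "\<And>k. k \<in> A \<Longrightarrow> nu2 (f k) = Fin (g k)"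
  shows "nu2 (prod f A) = Fin (sum g A)"
  using assms
proof (induction rule: finite_induct)
  case empty
  then show ?case
    using nu2_of_nat[of 1] by (simp add: zero_extended_def)
qed (simp add: nu2_mult)

text \<open>
  All factors \<open>a - 2^e i\<close> of the numerator are odd since \<open>e > 0\<close>, so only the denominators
  \<open>2^e\<close> and the factorial count.
\<close>

lemma nu2_gchoose_fraction:
  assumes "odd a" "e > 0"
  shows "nu2 ((of_int a / 2 ^ e) gchoose j) = Fin (- int (e * j + fact_val j))"
proof -
  define P where "P = (\<Prod>i<j. a - 2 ^ e * int i)"
  have "odd P"
    using assms by (simp add: P_def prime_dvd_prod_iff)
  then have P: "P \<noteq> 0" "multiplicity 2 P = 0"
    by (auto simp: not_dvd_imp_multiplicity_0)
  have "(of_int a / 2 ^ e :: rat) gchoose j = (\<Prod>i<j. of_int a / 2 ^ e - of_nat i) / fact j"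
    by (simp add: gbinomial_prod_rev atLeast0LessThan)
  also have "(\<Prod>i<j. of_int a / 2 ^ e - of_nat i) = (\<Prod>i<j. of_int (a - 2 ^ e * int i) / (2 ^ e :: rat))"
    by (intro prod.cong) (auto simp: field_simps)
  also have "\<dots> = of_int P / (2 ^ e) ^ j"
    by (simp add: P_def prod_dividef)
  finally have "(of_int a / 2 ^ e :: rat) gchoose j = of_int P / of_int (2 ^ (e * j) * fact j)"
    by (simp add: power_mult)
  moreover have "multiplicity 2 (2 ^ (e * j) * fact j :: int)
      = multiplicity 2 (2 ^ (e * j) :: int) + multiplicity 2 (fact j :: int)"
    by (intro prime_elem_multiplicity_mult_distrib) auto
  moreover have "multiplicity 2 (fact j :: int) = fact_val j"
    using multiplicity_2_int[of "fact j"] by (simp add: fact_val_def)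
  moreover have "multiplicity 2 (2 ^ (e * j) :: int) = e * j"
    by (rule multiplicity_same_power) auto
  ultimately show ?thesis
    using P nu2_divide[of P "2 ^ (e * j) * fact j"] by simp
qed

text \<open>Negating the upper index turns the coefficient into \<open>N choose t\<close> up to sign.\<close>

lemma nu2_gchoose_negated:
  "nu2 (of_int (int t - 1 - int N) gchoose t)
    = (if N < t then \<infinity> else Fin (int (multiplicity 2 (N choose t))))"
proof -
  have "(of_int (int t - 1 - int N) :: rat) gchoose t = (- 1) ^ t * (of_nat N gchoose t)"
    by (subst gbinomial_negated_upper) simp
  also have "\<dots> = (- 1) ^ t * of_nat (N choose t)"
    by (simp add: binomial_gbinomial)
  finally have "nu2 (of_int (int t - 1 - int N) gchoose t) = nu2 (of_nat (N choose t))"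
    by (cases "even t") (simp_all add: nu2_minus)
  also have "\<dots> = (if N < t then \<infinity> else Fin (int (multiplicity 2 (N choose t))))"
    using nu2_of_nat[of "N choose t"] by (simp add: nu2_def binomial_eq_0)
  finally show ?thesis .
qed

section \<open>A closed form for V\<close>

text \<open>
  The part of \<open>V\<close> that comes from all entries except the last one: the entry with index \<open>k\<close> has
  \<open>\<alpha>(k)\<close> odd over \<open>2^(n-k)\<close>.
\<close>

definition gain :: "nat \<Rightarrow> nat list \<Rightarrow> nat" where
  "gain n js = (\<Sum>k=1..<n. (n - k) * entry js k + fact_val (entry js k))"

lemma sum_entries:
  assumes "js \<in> J m n"
  shows "(\<Sum>k=1..n. 2 ^ (n - k + 1) * entry js k) = m + 1 + (\<Sum>k=1..n. entry js k)"
proof -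
  have "(\<Sum>k=1..n. 2 ^ (n - k + 1) * entry js k)
      = (\<Sum>k=1..n. (2 ^ (n - k + 1) - 1) * entry js k + entry js k)"
    by (intro sum.cong) (auto simp: algebra_simps)
  then show ?thesis
    using assms by (simp add: J_def sum.distrib)
qed

text \<open>
  Twice the subtracted sum in \<open>\<alpha>(n)\<close> is, up to its last term, the left-hand side of \<open>sum_entries\<close>, so
  membership in \<open>J\<close> eliminates \<open>m\<close> and leaves only the sum of the entries.
\<close>

lemma \<alpha>_last:
  assumes "js \<in> J m n" "n > 0" "(\<Sum>k=1..n. entry js k) = 2 * N + 1"
  shows "\<alpha> m n js n = of_int (int (entry js n) - 1 - int N)"
proof -
  define s where "s = (\<Sum>i=1..<n. 2 ^ (n - i) * entry js i)"
  have "(\<Sum>k=1..n. 2 ^ (n - k + 1) * entry js k)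
      = (\<Sum>k=1..<n. 2 ^ (n - k + 1) * entry js k) + 2 * entry js n"
    using assms(2) by (simp add: sum.last_plus)
  also have "(\<Sum>k=1..<n. 2 ^ (n - k + 1) * entry js k) = 2 * s"
    unfolding s_def sum_distrib_left by (intro sum.cong) auto
  finally have "2 * s + 2 * entry js n = m + 2 * N + 2"
    using sum_entries[OF assms(1)] assms(3) by simp
  then have "rat_of_nat (2 * s + 2 * entry js n) = rat_of_nat (m + 2 * N + 2)"
    by simp
  moreover have "\<alpha> m n js n = of_nat m / 2 - of_nat s"
    by (simp add: \<alpha>_def s_def)
  ultimately show ?thesis
    by (simp add: field_simps)
qed

lemma V_eq:
  assumes J: "js \<in> J m n" and "n > 0" "m mod 4 = 2"
    and N: "(\<Sum>k=1..n. entry js k) = 2 * N + 1"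
  shows "V m n js = (if N < entry js n then - \<infinity>
    else Fin (int (gain n js) - int (multiplicity 2 (N choose entry js n))))"
proof -
  define h where "h = m div 2"
  have h: "m = 2 * h" "odd h"
    using assms(3) unfolding h_def by presburger+
  let ?f = "\<lambda>k. \<alpha> m n js k gchoose entry js k"
  \<comment> \<open>For \<open>k < n\<close> the sum in \<open>\<alpha>(k)\<close> is an integer, so it does not affect the parity of the
    numerator \<open>h\<close> over \<open>2^(n-k)\<close>.\<close>
  have "nu2 (?f k) = Fin (- int ((n - k) * entry js k + fact_val (entry js k)))"
    if k: "k \<in> {1..<n}" for k
  proof -
    define z where "z = (\<Sum>i=1..<k. 2 ^ (k - i) * int (entry js i))"
    have "\<alpha> m n js k = of_int (int h - 2 ^ (n - k) * z) / 2 ^ (n - k)"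
      by (simp add: \<alpha>_def h z_def field_simps)
    moreover have "odd (int h - 2 ^ (n - k) * z)"
      using h k by simp
    ultimately show ?thesis
      using nu2_gchoose_fraction[of "int h - 2 ^ (n - k) * z" "n - k"] k by simp
  qed
  then have "nu2 (\<Prod>k=1..<n. ?f k)
      = Fin (\<Sum>k=1..<n. - int ((n - k) * entry js k + fact_val (entry js k)))"
    by (intro nu2_prod) auto
  also have "(\<Sum>k=1..<n. - int ((n - k) * entry js k + fact_val (entry js k))) = - int (gain n js)"
    by (simp only: gain_def sum_negf of_nat_sum)
  finally have "nu2 (\<Prod>k=1..<n. ?f k) = Fin (- int (gain n js))" .
  moreover have "(\<Prod>k=1..n. ?f k) = (\<Prod>k=1..<n. ?f k) * ?f n"
    using assms(2) by (simp add: prod.last_plus mult.commute)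
  moreover have "nu2 (?f n) = (if N < entry js n then \<infinity>
      else Fin (int (multiplicity 2 (N choose entry js n))))"
    unfolding \<alpha>_last[OF J \<open>n > 0\<close> N] by (rule nu2_gchoose_negated)
  ultimately show ?thesis
    by (simp add: V_def nu2_mult)
qed

lemma sum_entries_odd:
  assumes "js \<in> J m n" "even m"
  shows "odd (\<Sum>k=1..n. entry js k)"
proof -
  have "even (\<Sum>k=1..n. 2 ^ (n - k + 1) * entry js k)"
    by (intro dvd_sum) auto
  then show ?thesis
    using sum_entries[OF assms(1)] assms(2) by auto
qed

lemma V_le_gain:
  assumes "js \<in> J m n" "n > 0" "m mod 4 = 2"
  shows "V m n js \<le> Fin (int (gain n js))"
proof -
  have "even m"
    using assms(3) by presburger
  then obtain N where "(\<Sum>k=1..n. entry js k) = 2 * N + 1"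
    using sum_entries_odd[OF assms(1)] by (blast elim: oddE)
  from V_eq[OF assms this] show ?thesis
    by auto
qed

section \<open>Maximizing the gain\<close>

text \<open>
  Sums over the entries of the tuples in the theorem reduce to the two or three entries at the end.
  The first equation of each pair leaves out the last entry, as \<open>gain\<close> does.
\<close>

lemma sum_tail2:
  assumes "\<And>k. g k 0 = (0::nat)"
  shows "(\<Sum>k=1..Suc q. g k (entry (replicate q 0 @ [a, b]) k)) = g (Suc q) a"
    and "(\<Sum>k=1..Suc (Suc q). g k (entry (replicate q 0 @ [a, b]) k))
      = g (Suc q) a + g (Suc (Suc q)) b"
proof -
  have "(\<Sum>k=1..q. g k (entry (replicate q 0 @ [a, b]) k)) = 0"
    using assms by (intro sum.neutral) (auto simp: entry_def nth_append)
  then show "(\<Sum>k=1..Suc q. g k (entry (replicate q 0 @ [a, b]) k)) = g (Suc q) a"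
    "(\<Sum>k=1..Suc (Suc q). g k (entry (replicate q 0 @ [a, b]) k))
      = g (Suc q) a + g (Suc (Suc q)) b"
    by (simp_all add: entry_def nth_append)
qed

lemma sum_tail3:
  assumes "\<And>k. g k 0 = (0::nat)"
  shows "(\<Sum>k=1..Suc (Suc r). g k (entry (replicate r 0 @ [c, a, b]) k))
      = g (Suc r) c + g (Suc (Suc r)) a"
    and "(\<Sum>k=1..Suc (Suc (Suc r)). g k (entry (replicate r 0 @ [c, a, b]) k))
      = g (Suc r) c + g (Suc (Suc r)) a + g (Suc (Suc (Suc r))) b"
proof -
  have "(\<Sum>k=1..r. g k (entry (replicate r 0 @ [c, a, b]) k)) = 0"
    using assms by (intro sum.neutral) (auto simp: entry_def nth_append)
  then show "(\<Sum>k=1..Suc (Suc r). g k (entry (replicate r 0 @ [c, a, b]) k))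
      = g (Suc r) c + g (Suc (Suc r)) a"
    "(\<Sum>k=1..Suc (Suc (Suc r)). g k (entry (replicate r 0 @ [c, a, b]) k))
      = g (Suc r) c + g (Suc (Suc r)) a + g (Suc (Suc (Suc r))) b"
    by (simp_all add: entry_def nth_append)
qed

lemma tail_2:
  assumes "n \<ge> 2"
  shows "replicate (n - 2) 0 @ [a, b] \<in> J m n \<longleftrightarrow> 3 * a + b = m + 1"
    and "gain n (replicate (n - 2) 0 @ [a, b]) = a + fact_val a"
    and "(\<Sum>k=1..n. entry (replicate (n - 2) 0 @ [a, b]) k) = a + b"
    and "entry (replicate (n - 2) 0 @ [a, b]) n = b"
proof -
  obtain q where n: "n = Suc (Suc q)"
    using assms by (metis Suc_le_D numeral_2_eq_2 Suc_le_mono)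
  show "replicate (n - 2) 0 @ [a, b] \<in> J m n \<longleftrightarrow> 3 * a + b = m + 1"
    using sum_tail2(2)[of "\<lambda>k x. (2 ^ (n - k + 1) - 1) * x" q a b] by (simp add: J_def n)
  show "gain n (replicate (n - 2) 0 @ [a, b]) = a + fact_val a"
    using sum_tail2(1)[of "\<lambda>k x. (n - k) * x + fact_val x" q a b]
    by (simp add: gain_def n atLeastLessThanSuc_atLeastAtMost)
  show "(\<Sum>k=1..n. entry (replicate (n - 2) 0 @ [a, b]) k) = a + b"
    using sum_tail2(2)[of "\<lambda>k x. x" q a b] by (simp add: n)
  show "entry (replicate (n - 2) 0 @ [a, b]) n = b"
    by (simp add: entry_def n nth_append)
qed

lemma tail_3:
  assumes "n \<ge> 3"
  shows "replicate (n - 3) 0 @ [c, a, b] \<in> J m n \<longleftrightarrow> 7 * c + 3 * a + b = m + 1"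
    and "gain n (replicate (n - 3) 0 @ [c, a, b]) = 2 * c + fact_val c + (a + fact_val a)"
    and "(\<Sum>k=1..n. entry (replicate (n - 3) 0 @ [c, a, b]) k) = c + a + b"
    and "entry (replicate (n - 3) 0 @ [c, a, b]) n = b"
proof -
  obtain r where n: "n = Suc (Suc (Suc r))"
    using assms by (metis Suc_le_D numeral_3_eq_3 Suc_le_mono)
  let ?js = "replicate (n - 3) 0 @ [c, a, b]"
  show "?js \<in> J m n \<longleftrightarrow> 7 * c + 3 * a + b = m + 1"
    using sum_tail3(2)[of "\<lambda>k x. (2 ^ (n - k + 1) - 1) * x" r c a b] by (simp add: J_def n)
  show "gain n ?js = 2 * c + fact_val c + (a + fact_val a)"
    using sum_tail3(1)[of "\<lambda>k x. (n - k) * x + fact_val x" r c a b]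
    by (simp add: gain_def n atLeastLessThanSuc_atLeastAtMost)
  show "(\<Sum>k=1..n. entry ?js k) = c + a + b"
    using sum_tail3(2)[of "\<lambda>k x. x" r c a b] by (simp add: n)
  show "entry ?js n = b"
    by (simp add: entry_def n nth_append)
qed

text \<open>
  For \<open>i \<ge> 4\<close> the weight \<open>2^i - 1\<close> is at least \<open>2i + 7\<close>, while twice the contribution of the entry is
  at most \<open>2 i x - 2\<close> for \<open>x > 0\<close>. For \<open>i = 4\<close> the surplus \<open>7\<close> is exact.
\<close>

lemma heavy_entry_bound:
  assumes "i \<ge> 4"
  shows "2 * ((i - 1) * x + fact_val x) + 7 * x + (if x > 0 then 2 else 0) \<le> (2 ^ i - 1) * x"
proof (cases "x = 0")
  case False
  define d where "d = i - 4"
  have i: "i = d + 4"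
    using assms by (simp add: d_def)
  have "2 * d + 16 \<le> (16::nat) * 2 ^ d"
    by (induction d) auto
  then have "2 * d + 16 \<le> (2::nat) ^ i"
    by (simp add: i power_add)
  then have "2 * (i - 1) + 9 \<le> 2 ^ i - 1"
    by (simp add: i)
  then have "(2 * (i - 1) + 9) * x \<le> (2 ^ i - 1) * x"
    by (rule mult_le_mono1)
  then show ?thesis
    using False fact_val_less[of x] by (simp add: algebra_simps)
qed simp

text \<open>
  All that the optimization needs to know about a tuple. The numbers \<open>t\<close>, \<open>x2\<close>, \<open>x3\<close> are the last
  three entries (\<open>x3 = 0\<close> if \<open>n = 2\<close>) and \<open>R\<close> is the sum of the remaining ones; \<open>A\<close> is the total
  weight, and \<open>B\<close> the total contribution to the gain, of \<open>x3\<close> and the remaining entries. The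
  inequality between \<open>A\<close> and \<open>B\<close> adds \<open>heavy_entry_bound\<close> for the remaining entries to
  \<open>2 (2 x3 + u(x3)) \<le> 6 x3 - 2\<close>; one summand \<open>2\<close> is available as soon as some entry is nonzero.
\<close>

lemma J_decompose:
  assumes "js \<in> J m n" "n \<ge> 2"
  obtains x2 t x3 R A B where
    "A + 3 * x2 + t = m + 1"
    "gain n js = B + x2 + fact_val x2"
    "x3 + R > 0 \<Longrightarrow> 2 * B + x3 + 7 * R + 2 \<le> A"
    "R = 0 \<Longrightarrow> A = 7 * x3 \<and> B = 2 * x3 + fact_val x3"
    "R = 0 \<Longrightarrow> x3 = 0 \<Longrightarrow> js = replicate (n - 2) 0 @ [x2, t]"
    "R = 0 \<Longrightarrow> x3 > 0 \<Longrightarrow> js = replicate (n - 3) 0 @ [x3, x2, t]"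
proof (cases "n = 2")
  case True
  define x2 t where "x2 = entry js 1" and "t = entry js 2"
  have len: "length js = 2"
    using assms by (simp add: J_def True)
  then have "js = [x2, t]"
    by (auto simp: x2_def t_def entry_def numeral_2_eq_2 length_Suc_conv)
  moreover have "3 * x2 + t = m + 1"
    using assms(1) tail_2(1)[of 2 x2 t m] calculation True by simp
  moreover have "gain n js = x2 + fact_val x2"
    using tail_2(2)[of 2 x2 t] calculation True by simp
  ultimately show ?thesis
    using that[of 0 x2 t 0 0 0] True by simp
next
  case False
  then obtain r where n: "n = Suc (Suc (Suc r))"
    using assms(2) by (metis Suc_le_D numeral_2_eq_2 Suc_le_mono le_antisym not_less_eq_eq)
  define x3 x2 t R where "x3 = entry js (Suc r)" and "x2 = entry js (Suc (Suc r))"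
    and "t = entry js n" and "R = (\<Sum>k=1..r. entry js k)"
  define A B where "A = (\<Sum>k=1..r. (2 ^ (n - k + 1) - 1) * entry js k)"
    and "B = (\<Sum>k=1..r. (n - k) * entry js k + fact_val (entry js k))"
  define h where "h = (\<Sum>k=1..r. if entry js k > 0 then 2 else (0::nat))"
  have "A + 7 * x3 + 3 * x2 + t = m + 1"
    using assms(1) by (simp add: J_def n A_def x3_def x2_def t_def)
  moreover have "gain n js = B + (2 * x3 + fact_val x3) + x2 + fact_val x2"
    by (simp add: gain_def n B_def x3_def x2_def atLeastLessThanSuc_atLeastAtMost)
  moreover have AB: "2 * B + 7 * R + h \<le> A"
  proof -
    have "2 * B + 7 * R + h = (\<Sum>k=1..r. 2 * ((n - k) * entry js k + fact_val (entry js k))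
        + 7 * entry js k + (if entry js k > 0 then 2 else 0))"
      unfolding B_def R_def h_def by (simp add: sum.distrib sum_distrib_left)
    also have "\<dots> \<le> A"
      unfolding A_def
    proof (intro sum_mono)
      fix k
      assume "k \<in> {1..r}"
      then have "4 \<le> n - k + 1"
        by (auto simp: n)
      from heavy_entry_bound[OF this, of "entry js k"]
      show "2 * ((n - k) * entry js k + fact_val (entry js k))
          + 7 * entry js k + (if entry js k > 0 then 2 else 0) \<le> (2 ^ (n - k + 1) - 1) * entry js k"
        by (simp only: add_diff_cancel_right')
    qed
    finally show ?thesis .
  qed
  moreover have "2 * (B + (2 * x3 + fact_val x3)) + x3 + 7 * R + 2 \<le> A + 7 * x3" if "x3 + R > 0"
  proof (cases "x3 = 0")
    case True
    then have "\<exists>k\<in>{1..r}. entry js k > 0"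
      using that True unfolding R_def by (metis add_0 gr0I not_less_zero sum.neutral)
    then obtain k where k: "k \<in> {1..r}" "entry js k > 0"
      by blast
    have "(if entry js k > 0 then 2 else (0::nat)) \<le> h"
      unfolding h_def by (rule member_le_sum) (use k in auto)
    then show ?thesis
      using AB True k by simp
  next
    case False
    then show ?thesis
      using AB fact_val_less[of x3] by simp
  qed
  moreover have zero: "entry js k = 0" if "R = 0" "k \<in> {1..r}" for k
    using that by (simp add: R_def)
  moreover have "A = 0 \<and> B = 0" if "R = 0"
    using zero[OF that] by (simp add: A_def B_def)
  moreover have js: "js = replicate (n - 3) 0 @ [x3, x2, t]" if "R = 0"
  proof (rule nth_equalityI)
    show "length js = length (replicate (n - 3) 0 @ [x3, x2, t])"
      using assms by (simp add: J_def n)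
    fix i
    assume "i < length js"
    then have "i < r \<or> i = r \<or> i = Suc r \<or> i = Suc (Suc r)"
      using assms(1) by (auto simp: J_def n)
    then show "js ! i = (replicate (n - 3) 0 @ [x3, x2, t]) ! i"
      using zero[OF that, of "Suc i"]
      by (auto simp: n nth_append x3_def x2_def t_def entry_def)
  qed
  moreover have "js = replicate (n - 2) 0 @ [x2, t]" if "R = 0" "x3 = 0"
    using js[OF that(1)] that(2) by (simp add: n replicate_append_same[symmetric])
  ultimately show ?thesis
    using that[of "A + 7 * x3" x2 t "B + (2 * x3 + fact_val x3)" x3 R] by simp
qed

text \<open>
  The entries other than \<open>x2\<close> use the weight \<open>A + t = 3 W + c\<close>, which would allow raising \<open>x2\<close> by \<open>W\<close>
  at the price of leaving \<open>c\<close> in the last place; the proof shows that this exchange pays off.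
\<close>

lemma gain_less:
  assumes J: "js \<in> J m n" and "n \<ge> 2" and p: "m + 1 = 3 * p + c" "c \<le> 2"
    and neq: "js \<noteq> replicate (n - 2) 0 @ [p, c]"
  shows "gain n js < p + fact_val p"
proof -
  obtain x2 t x3 R A B where
    d: "A + 3 * x2 + t = m + 1" "gain n js = B + x2 + fact_val x2"
    "x3 + R > 0 \<Longrightarrow> 2 * B + x3 + 7 * R + 2 \<le> A"
    "R = 0 \<Longrightarrow> A = 7 * x3 \<and> B = 2 * x3 + fact_val x3"
    "R = 0 \<Longrightarrow> x3 = 0 \<Longrightarrow> js = replicate (n - 2) 0 @ [x2, t]"
    using J_decompose[OF J \<open>n \<ge> 2\<close>] by metis
  define W where "W = p - x2"
  have W: "p = x2 + W" "3 * W + c = A + t"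
    using d(1) p unfolding W_def by linarith+
  have "B < W + fact_val W"
  proof (cases "x3 + R > 0")
    case True
    \<comment> \<open>The inequalities for \<open>B\<close> and \<open>fact_val W\<close> suffice unless \<open>x3 + 7 R + t < c\<close>, which leaves only
      \<open>x3 = 1\<close> and \<open>c = 2\<close>; then the weight \<open>7\<close> would have to be \<open>2\<close> modulo \<open>3\<close>.\<close>
    have "c < x3 + 7 * R + t + 1"
    proof (rule ccontr)
      assume "\<not> ?thesis"
      then have "R = 0" "x3 = 1" "t = 0" "c = 2"
        using True p(2) by linarith+
      then have "3 * W + 2 = 7"
        using d(4) W by simp
      then show False
        by presburger
    qed
    then show ?thesis
      using d(3)[OF True] W(2) fact_val_ge[of W] by linarith
  next
    case False
    then have "x3 = 0" "R = 0" "A = 0" "B = 0" "js = replicate (n - 2) 0 @ [x2, t]"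
      using d(4,5) by auto
    moreover have "W > 0"
      using calculation neq W by (cases W) auto
    ultimately show ?thesis
      by simp
  qed
  moreover have "fact_val x2 + fact_val W \<le> fact_val p"
    using fact_val_superadditive[of x2 W] W(1) by simp
  ultimately show ?thesis
    using d(2) W(1) by linarith
qed

text \<open>
  The estimate of \<open>gain_less\<close> with one more unit of slack forces \<open>x3 + 7 R + t \<le> 3\<close> or \<open>W \<le> 1\<close>, and
  the weight modulo \<open>3\<close> eliminates most of the finitely many tails that remain.
\<close>

lemma gain_second_largest:
  assumes J: "js \<in> J m n" and "n \<ge> 2" and p: "m + 1 = 3 * p + 2"
    and neq: "js \<noteq> replicate (n - 2) 0 @ [p, 2]"
      "js \<noteq> replicate (n - 3) 0 @ [1, p - 2, 1]"
      "js \<noteq> replicate (n - 2) 0 @ [p - 1, 5]"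
  shows "gain n js + 1 < p + fact_val p"
proof -
  obtain x2 t x3 R A B where
    d: "A + 3 * x2 + t = m + 1" "gain n js = B + x2 + fact_val x2"
    "x3 + R > 0 \<Longrightarrow> 2 * B + x3 + 7 * R + 2 \<le> A"
    "R = 0 \<Longrightarrow> A = 7 * x3 \<and> B = 2 * x3 + fact_val x3"
    "R = 0 \<Longrightarrow> x3 = 0 \<Longrightarrow> js = replicate (n - 2) 0 @ [x2, t]"
    "R = 0 \<Longrightarrow> x3 > 0 \<Longrightarrow> js = replicate (n - 3) 0 @ [x3, x2, t]"
    using J_decompose[OF J \<open>n \<ge> 2\<close>] by metis
  define W where "W = p - x2"
  have W: "p = x2 + W" "3 * W + 2 = A + t"
    using d(1) p unfolding W_def by linarith+
  have "B + 1 < W + fact_val W"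
  proof (rule ccontr)
    assume neg: "\<not> ?thesis"
    show False
    proof (cases "x3 + R > 0")
      case True
      have "x3 + 7 * R + t \<le> 3"
        using d(3)[OF True] W(2) fact_val_ge[of W] neg by linarith
      then have R: "R = 0" and le: "x3 + t \<le> 3" and x3: "x3 > 0"
        using True by linarith+
      have eq: "3 * W + 2 = 7 * x3 + t"
        using W(2) d(4) R by simp
      have "x3 = 1 \<or> x3 = 2 \<or> x3 = 3"
        using le x3 by linarith
      then consider "x3 = 1" "t = 1" "W = 2" | "x3 = 2" "t = 0" "W = 4"
        using eq le by (elim disjE) (simp_all, presburger+)
      then show False
      proof cases
        case 1
        then show False
          using d(6) R neq(2) W(1) by simp
      next
        case 2
        \<comment> \<open>Two entries of weight \<open>7\<close> give \<open>B = 5\<close>, but \<open>W + u(W) = 4 + 3\<close>.\<close>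
        then show False
          using d(4) R neg by simp
      qed
    next
      case False
      then have *: "x3 = 0" "R = 0" "A = 0" "B = 0" "js = replicate (n - 2) 0 @ [x2, t]"
        using d(4,5) by auto
      then have "W \<le> 1"
        using neg by simp
      then consider "W = 0" "t = 2" | "W = 1" "t = 5"
        using W(2) *(3) by (cases W) auto
      then show False
        using * W(1) neq(1,3) by cases simp_all
    qed
  qed
  moreover have "fact_val x2 + fact_val W \<le> fact_val p"
    using fact_val_superadditive[of x2 W] W(1) by simp
  ultimately show ?thesis
    using d(2) W(1) by linarith
qed

section \<open>The maximizers of V\<close>

lemma maximizers_eqI:
  assumes "S \<noteq> {}" "S \<subseteq> J m n"
    and "\<And>js. js \<in> S \<Longrightarrow> V m n js = M"
    and "\<And>js. js \<in> J m n \<Longrightarrow> js \<notin> S \<Longrightarrow> V m n js < M"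
  shows "maximizers m n = S"
proof (intro set_eqI iffI)
  fix js
  assume "js \<in> maximizers m n"
  then have js: "js \<in> J m n" "\<And>y. y \<in> J m n \<Longrightarrow> \<not> V m n js < V m n y"
    by (auto simp: maximizers_def is_arg_max_def)
  obtain s where "s \<in> S"
    using assms(1) by blast
  then have "\<not> V m n js < M"
    using js(2)[of s] assms(2,3) by auto
  then show "js \<in> S"
    using assms(4) js(1) by blast
next
  fix js
  assume js: "js \<in> S"
  have "\<not> M < V m n y" if "y \<in> J m n" for y
    using assms(3)[of y] assms(4)[OF that] by (cases "y \<in> S") auto
  then show "js \<in> maximizers m n"
    using assms(2,3) js by (auto simp: maximizers_def is_arg_max_def)
qed

lemma V_tail_2:
  assumes "n \<ge> 2" "m mod 4 = 2" "3 * a + b = m + 1" "a + b = 2 * N + 1" "b \<le> N"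
  shows "V m n (replicate (n - 2) 0 @ [a, b])
    = Fin (int (a + fact_val a) - int (multiplicity 2 (N choose b)))"
  using V_eq[of "replicate (n - 2) 0 @ [a, b]" m n N] tail_2[OF assms(1), of a b] assms by simp

lemma V_tail_3:
  assumes "n \<ge> 3" "m mod 4 = 2" "7 * c + 3 * a + b = m + 1" "c + a + b = 2 * N + 1" "b \<le> N"
  shows "V m n (replicate (n - 3) 0 @ [c, a, b])
    = Fin (int (2 * c + fact_val c + (a + fact_val a)) - int (multiplicity 2 (N choose b)))"
  using V_eq[of "replicate (n - 3) 0 @ [c, a, b]" m n N] tail_3[OF assms(1), of c a b] assms by simp

text \<open>
  An odd coefficient \<open>N choose c\<close> lets the tuple of largest gain keep all of it in \<open>V\<close>, while
  \<open>V\<close> never exceeds the gain.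
\<close>

lemma maximizers_unique:
  assumes "n \<ge> 2" "m mod 4 = 2" and p: "m + 1 = 3 * p + c" "c \<le> 2"
    and N: "p + c = 2 * N + 1" "odd (N choose c)"
  shows "maximizers m n = {replicate (n - 2) 0 @ [p, c]}"
proof (rule maximizers_eqI)
  let ?js = "replicate (n - 2) 0 @ [p, c]"
  show "{?js} \<subseteq> J m n"
    using tail_2(1)[OF assms(1)] p by simp
  have "c \<le> N"
    using N(2) by (metis binomial_eq_0 even_zero not_le)
  then have "V m n ?js = Fin (int (p + fact_val p))"
    using V_tail_2[OF assms(1,2), of p c N] p N by (simp add: not_dvd_imp_multiplicity_0)
  then show "js \<in> {?js} \<Longrightarrow> V m n js = Fin (int (p + fact_val p))" for js
    by simp
  show "V m n js < Fin (int (p + fact_val p))" if "js \<in> J m n" "js \<notin> {?js}" for js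
  proof -
    have "V m n js \<le> Fin (int (gain n js))"
      using V_le_gain that(1) assms(1,2) by simp
    also have "\<dots> < Fin (int (p + fact_val p))"
      using gain_less[OF that(1) assms(1) p] that(2) by simp
    finally show ?thesis .
  qed
qed simp

text \<open>
  The coefficient of the tuple \<open>(0,\<dots>,0,p-1,5)\<close> has upper index \<open>(p + 3) / 2\<close>, which is \<open>8 k + 5\<close> for
  \<open>p = 16 k + 7\<close> and \<open>8 k + 9\<close> for \<open>p = 16 k + 15\<close>. Its parity follows by cancelling the \<open>8\<close> in
  \<open>5! = 8 * 15\<close>.
\<close>

lemma choose_5: "120 * ((x + 5) choose 5) = (x + 5) * (x + 4) * (x + 3) * (x + 2) * (x + 1)"
proof -
  have "5 * ((x + 5) choose 5) = (x + 5) * ((x + 4) choose 4)"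
    using Suc_times_binomial_eq[of "x + 4" 4] by (simp add: ac_simps)
  moreover have "4 * ((x + 4) choose 4) = (x + 4) * ((x + 3) choose 3)"
    using Suc_times_binomial_eq[of "x + 3" 3] by (simp add: ac_simps)
  moreover have "3 * ((x + 3) choose 3) = (x + 3) * ((x + 2) choose 2)"
    using Suc_times_binomial_eq[of "x + 2" 2] by (simp add: eval_nat_numeral algebra_simps)
  moreover have "2 * ((x + 2) choose 2) = (x + 2) * (x + 1)"
    using Suc_times_binomial_eq[of "x + 1" 1] by (simp add: eval_nat_numeral algebra_simps)
  ultimately show ?thesis
    by algebra
qed

lemma odd_choose_5: "odd ((8 * k + 5) choose 5)"
proof -
  have "8 * (15 * ((8 * k + 5) choose 5))
      = 8 * ((8 * k + 5) * (2 * k + 1) * (8 * k + 3) * (4 * k + 1) * (8 * k + 1))"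
    using choose_5[of "8 * k"] by algebra
  then have "15 * ((8 * k + 5) choose 5)
      = (8 * k + 5) * (2 * k + 1) * (8 * k + 3) * (4 * k + 1) * (8 * k + 1)"
    by linarith
  then have "odd (15 * ((8 * k + 5) choose 5))"
    by simp
  then show ?thesis
    by simp
qed

lemma even_choose_5: "even ((8 * k + 9) choose 5)"
proof -
  have "8 * (15 * ((8 * k + 9) choose 5))
      = 8 * (2 * ((8 * k + 9) * (k + 1) * (8 * k + 7) * (4 * k + 3) * (8 * k + 5)))"
    using choose_5[of "8 * k + 4"] by (simp add: algebra_simps)
  then have "15 * ((8 * k + 9) choose 5)
      = 2 * ((8 * k + 9) * (k + 1) * (8 * k + 7) * (4 * k + 3) * (8 * k + 5))"
    by linarith
  then have "even (15 * ((8 * k + 9) choose 5))"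
    by simp
  then show ?thesis
    by simp
qed

lemma choose_2_double: "(2 * x) choose 2 = x * (2 * x - 1)"
  by (simp add: choose_two)

text \<open>
  The candidates in the case \<open>p \<equiv> 7 (mod 8)\<close>. As \<open>p\<close> and \<open>(p - 1) / 2\<close> are odd, \<open>p (p - 1)\<close> is
  divisible by \<open>2\<close> but not by \<open>4\<close>; thus lowering \<open>p\<close> to \<open>p - 1\<close> does not change \<open>fact_val\<close> and lowering
  it to \<open>p - 2\<close> costs exactly one. The tuple \<open>(0,\<dots>,0,1,p-2,1)\<close> attains the second largest gain with
  the odd coefficient \<open>(p - 1) / 2 choose 1\<close>, which makes \<open>M\<close> the value to compare with.
\<close>

lemma values_near_top:
  assumes "n \<ge> 3" "m mod 4 = 2" "m + 1 = 3 * p + 2" "p mod 8 = 7"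
  defines "M \<equiv> Fin (int (p + fact_val p) - 1)"
  shows "replicate (n - 3) 0 @ [1, p - 2, 1] \<in> J m n"
    and "V m n (replicate (n - 3) 0 @ [1, p - 2, 1]) = M"
    and "replicate (n - 2) 0 @ [p, 2] \<in> J m n"
    and "V m n (replicate (n - 2) 0 @ [p, 2])
      = Fin (int (p + fact_val p) - int (multiplicity 2 (((p + 1) div 2) choose 2)))"
    and "replicate (n - 2) 0 @ [p - 1, 5] \<in> J m n"
    and "V m n (replicate (n - 2) 0 @ [p - 1, 5])
      = Fin (int (p + fact_val p) - 1 - int (multiplicity 2 (((p + 3) div 2) choose 5)))"
    and "\<lbrakk>js \<in> J m n; js \<noteq> replicate (n - 3) 0 @ [1, p - 2, 1];
      js \<noteq> replicate (n - 2) 0 @ [p, 2]; js \<noteq> replicate (n - 2) 0 @ [p - 1, 5]\<rbrakk>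
      \<Longrightarrow> V m n js < M"
proof -
  have n2: "n \<ge> 2"
    using assms(1) by simp
  obtain k where p: "p = 8 * k + 7"
    using assms(4) by (metis mult_div_mod_eq)
  have fp: "fact_val (p - 1) = fact_val p"
    using fact_val_Suc_even[of "8 * k + 6"] by (simp add: p add.commute)
  have "fact_val p = (4 * k + 3) + fact_val (4 * k + 3)"
    using fact_val_double[of "4 * k + 3"] fp by (simp add: p add.commute)
  moreover have "p - 2 = Suc (2 * (4 * k + 2))"
    by (simp add: p)
  then have "fact_val (p - 2) = (4 * k + 2) + fact_val (4 * k + 2)"
    by (simp only: fact_val_double fact_val_Suc_even dvd_triv_left)
  moreover have "fact_val (4 * k + 3) = fact_val (4 * k + 2)"
    using fact_val_Suc_even[of "4 * k + 2"] by (simp add: numeral_3_eq_3)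
  ultimately have fp2: "fact_val p = fact_val (p - 2) + 1"
    by simp
  show "replicate (n - 3) 0 @ [1, p - 2, 1] \<in> J m n"
    using tail_3(1)[OF assms(1), of 1 "p - 2" 1 m] assms(3) p by simp
  show "replicate (n - 2) 0 @ [p, 2] \<in> J m n"
    using tail_2(1)[OF n2, of p 2 m] assms(3) p by simp
  show "replicate (n - 2) 0 @ [p - 1, 5] \<in> J m n"
    using tail_2(1)[OF n2, of "p - 1" 5 m] assms(3) p by simp
  show "V m n (replicate (n - 3) 0 @ [1, p - 2, 1]) = M"
    using V_tail_3[OF assms(1,2), of 1 "p - 2" 1 "4 * k + 3"] assms(3) fp2
    by (simp add: M_def p not_dvd_imp_multiplicity_0)
  have half: "(p + 1) div 2 = 4 * k + 4" "(p + 3) div 2 = 4 * k + 5"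
    by (simp_all add: p)
  show "V m n (replicate (n - 2) 0 @ [p, 2])
      = Fin (int (p + fact_val p) - int (multiplicity 2 (((p + 1) div 2) choose 2)))"
    unfolding half by (rule V_tail_2[OF n2 assms(2)]) (use assms(3) p in simp_all)
  have "V m n (replicate (n - 2) 0 @ [p - 1, 5])
      = Fin (int (p - 1 + fact_val (p - 1)) - int (multiplicity 2 ((4 * k + 5) choose 5)))"
    by (rule V_tail_2[OF n2 assms(2)]) (use assms(3) p in simp_all)
  moreover have "int (p - 1 + fact_val (p - 1)) = int (p + fact_val p) - 1"
    unfolding fp using p by simp
  ultimately show "V m n (replicate (n - 2) 0 @ [p - 1, 5])
      = Fin (int (p + fact_val p) - 1 - int (multiplicity 2 (((p + 3) div 2) choose 5)))"
    unfolding half by simp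
  assume js: "js \<in> J m n" and neq: "js \<noteq> replicate (n - 3) 0 @ [1, p - 2, 1]"
      "js \<noteq> replicate (n - 2) 0 @ [p, 2]" "js \<noteq> replicate (n - 2) 0 @ [p - 1, 5]"
  have "V m n js \<le> Fin (int (gain n js))"
    using V_le_gain[OF js] n2 assms(2) by simp
  also have "\<dots> < M"
    using gain_second_largest[OF js n2 assms(3) neq(2,1,3)] by (simp add: M_def)
  finally show "V m n js < M" .
qed

theorem theorem19:
  fixes m n :: nat
  assumes "m > 0" and "n > 0"
    and "m mod 4 = 2"
    and "m \<le> 2 ^ (n + 1) - 3"
  shows "((m + 1) mod 3 = 0 \<longrightarrow>
            maximizers m n = {replicate (n - 2) 0 @ [(m + 1) div 3, 0]})
       \<and> ((m + 1) mod 3 = 1 \<longrightarrow>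
            maximizers m n = {replicate (n - 2) 0 @ [m div 3, 1]})
       \<and> ((m + 1) mod 3 = 2 \<longrightarrow>
            (m mod 8 = 2 \<longrightarrow>
               maximizers m n = {replicate (n - 2) 0 @ [(m - 1) div 3, 2]})
          \<and> (m mod 48 = 46 \<longrightarrow>
               maximizers m n = {replicate (n - 3) 0 @ [1, (m - 1) div 3 - 2, 1]})
          \<and> (m mod 48 = 22 \<longrightarrow>
               maximizers m n = {replicate (n - 3) 0 @ [1, (m - 7) div 3, 1],
                                 replicate (n - 2) 0 @ [(m - 1) div 3, 2],
                                 replicate (n - 2) 0 @ [(m - 4) div 3, 5]}))"
proof (intro conjI impI)
  \<comment> \<open>The bound on \<open>m\<close> ensures that the tuple is long enough for the displayed entries: \<open>n \<ge> 2\<close>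
    always holds, and \<open>n \<ge> 3\<close> when three entries are displayed, where \<open>m \<ge> 22\<close>.\<close>
  have "(2::nat) ^ 2 < 2 ^ (n + 1)"
    using assms by auto
  then have "2 < n + 1"
    by (rule power_less_imp_less_exp[rotated]) simp
  then have n2: "n \<ge> 2"
    by simp
  have n3: "n \<ge> 3" if "m \<ge> 6"
  proof -
    have "(2::nat) ^ 3 < 2 ^ (n + 1)"
      using assms(4) that by auto
    then have "3 < n + 1"
      by (rule power_less_imp_less_exp[rotated]) simp
    then show ?thesis
      by simp
  qed
  note mod4 = assms(3)
  then obtain a where a: "m = 4 * a + 2"
    by (metis mult_div_mod_eq)
  show "maximizers m n = {replicate (n - 2) 0 @ [(m + 1) div 3, 0]}" if "(m + 1) mod 3 = 0"
  proof -
    have "a mod 3 = 0"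
      using that unfolding a by presburger
    then obtain k where "a = 3 * k"
      by (metis add.right_neutral mult_div_mod_eq)
    then show ?thesis
      using maximizers_unique[OF n2 mod4, of "4 * k + 1" 0 "2 * k"] a by simp
  qed
  show "maximizers m n = {replicate (n - 2) 0 @ [m div 3, 1]}" if "(m + 1) mod 3 = 1"
  proof -
    have "a mod 3 = 1"
      using that unfolding a by presburger
    then obtain k where "a = 3 * k + 1"
      by (metis mult_div_mod_eq)
    then have "m = 12 * k + 6"
      using a by simp
    then show ?thesis
      using maximizers_unique[OF n2 mod4, of "4 * k + 2" 1 "2 * k + 1"] by simp
  qed
  assume mod3: "(m + 1) mod 3 = 2"
  show "maximizers m n = {replicate (n - 2) 0 @ [(m - 1) div 3, 2]}" if "m mod 8 = 2"
  proof -
    from that obtain b where b: "m = 8 * b + 2"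
      by (metis mult_div_mod_eq)
    have "b mod 3 = 1"
      using mod3 unfolding b by presburger
    then obtain k where "b = 3 * k + 1"
      by (metis mult_div_mod_eq)
    then have m: "m = 24 * k + 10"
      using b by simp
    have "odd ((4 * k + 2) choose 2)"
      using choose_2_double[of "2 * k + 1"] by simp
    then show ?thesis
      using maximizers_unique[OF n2 mod4, of "8 * k + 3" 2 "4 * k + 2"] by (simp add: m)
  qed
  show "maximizers m n = {replicate (n - 3) 0 @ [1, (m - 1) div 3 - 2, 1]}" if "m mod 48 = 46"
  proof -
    from that obtain k where m: "m = 48 * k + 46"
      by (metis mult_div_mod_eq)
    define p where "p = 16 * k + 15"
    have p: "m + 1 = 3 * p + 2" "p mod 8 = 7" "(m - 1) div 3 = p"
      and half: "(p + 1) div 2 = 2 * (4 * k + 4)" "(p + 3) div 2 = 8 * k + 9"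
      by (simp_all add: m p_def, presburger)
    have n3': "n \<ge> 3"
      using n3 by (simp add: m)
    note * = values_near_top[OF n3' mod4 p(1,2)]
    have "2 \<le> multiplicity 2 ((2 * (4 * k + 4)) choose 2)"
    proof (rule multiplicity_geI)
      show "2\<^sup>2 dvd (2 * (4 * k + 4)) choose 2"
        unfolding choose_2_double by simp
    qed simp_all
    moreover have "1 \<le> multiplicity 2 ((8 * k + 9) choose 5)"
      by (rule multiplicity_geI) (use even_choose_5[of k] in simp_all)
    ultimately have "V m n (replicate (n - 2) 0 @ [p, 2]) < Fin (int (p + fact_val p) - 1)"
      "V m n (replicate (n - 2) 0 @ [p - 1, 5]) < Fin (int (p + fact_val p) - 1)"
      unfolding *(4,6) half less_extended_simps by linarith+
    then have "V m n js < Fin (int (p + fact_val p) - 1)"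
      if "js \<in> J m n" "js \<noteq> replicate (n - 3) 0 @ [1, p - 2, 1]" for js
      using *(7)[OF that] by blast
    then show ?thesis
      unfolding p(3) using *(1,2) by (intro maximizers_eqI) simp_all
  qed
  show "maximizers m n = {replicate (n - 3) 0 @ [1, (m - 7) div 3, 1],
      replicate (n - 2) 0 @ [(m - 1) div 3, 2],
      replicate (n - 2) 0 @ [(m - 4) div 3, 5]}" if "m mod 48 = 22"
  proof -
    from that obtain k where m: "m = 48 * k + 22"
      by (metis mult_div_mod_eq)
    define p where "p = 16 * k + 7"
    have p: "m + 1 = 3 * p + 2" "p mod 8 = 7" "(m - 1) div 3 = p"
      "(m - 7) div 3 = p - 2" "(m - 4) div 3 = p - 1"
      and half: "(p + 1) div 2 = 2 * (4 * k + 2)" "(p + 3) div 2 = 8 * k + 5"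
      by (simp_all add: m p_def, presburger)
    have n3': "n \<ge> 3"
      using n3 by (simp add: m)
    note * = values_near_top[OF n3' mod4 p(1,2)]
    have "multiplicity 2 ((2 * (4 * k + 2)) choose 2) = 1"
    proof (rule multiplicity_eqI)
      define Q where "Q = (2 * k + 1) * (8 * k + 3)"
      have Q: "(2 * (4 * k + 2)) choose 2 = 2 * Q" "odd Q"
        unfolding choose_2_double Q_def by (simp_all add: algebra_simps)
      then show "2 ^ 1 dvd (2 * (4 * k + 2)) choose 2"
        by simp
      have "\<not> 4 dvd 2 * Q"
        using Q(2) by presburger
      then show "\<not> 2 ^ Suc 1 dvd (2 * (4 * k + 2)) choose 2"
        using Q(1) by simp
    qed
    moreover have "multiplicity 2 ((8 * k + 5) choose 5) = 0"
      using odd_choose_5[of k] by (simp add: not_dvd_imp_multiplicity_0)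
    ultimately have "V m n (replicate (n - 2) 0 @ [p, 2]) = Fin (int (p + fact_val p) - 1)"
      "V m n (replicate (n - 2) 0 @ [p - 1, 5]) = Fin (int (p + fact_val p) - 1)"
      unfolding *(4,6) half by simp_all
    then show ?thesis
      unfolding p(3-5) using *(1,2,3,5,7) by (intro maximizers_eqI) auto
  qed
qed

end
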